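(* For every $n\ge 1$, $\lambda\in\mathbb{R}_+$, $c\in\mathbb{R}$ such that $\psi^{(a)}$ has no points of increase in the interval $(c,c+1)$, and $a>0$, the monic Sobolev-type Charlier orthogonal polynomial $Q_n^\lambda$ has the hypergeometric representation $$Q_{n}^{\lambda }(x)=(-a)^{n-1}\left[ B_{1}(x;n)-aA_{1}(x;n)\right]\,{}_{3}F_{1}\left( -n,-x,1-\phi _{n,a}(x);-\phi _{n,a}(x);\frac{-1}{a}\right),$$ where $$\phi _{n,a}(x)=n\left( 1-a\,\frac{A_{1}(x;n)}{B_{1}(x;n)}\right).$$
   Context: Let $a>0$ and let $\psi^{(a)}$ be the Poisson distribution, the discrete measure with mass $e^{-a}a^{x}/x!$ at $x=0,1,2,\ldots$. "No points of increase in $(c,c+1)$" means that the open interval $(c,c+1)$ contains no nonnegative integer. Let $\Delta f(x)=f(x+1)-f(x)$. $\{C_n^{(a)}\}_{n\ge0}$ are the monic Charlier polynomials, orthogonal with respect to $\langle p,q\rangle=\int_0^\infty pq\,d\psi^{(a)}=\sum_{x\ge 0}p(x)q(x)e^{-a}a^x/x!$; they satisfy $C_{-1}^{(a)}=0$, $C_0^{(a)}=1$, $C_{n+1}^{(a)}(x)=(x-n-a)C_n^{(a)}(x)-na\,C_{n-1}^{(a)}(x)$, and $\|C_n^{(a)}\|^2=\langle C_n^{(a)},C_n^{(a)}\rangle=n!a^n$. $\{Q_n^\lambda\}_{n\ge0}$ is the sequence of monic polynomials ($\deg Q_n^\lambda=n$) orthogonal with respect to $\langle p,q\rangle_\lambda=\int_0^\infty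 p(x)q(x)\,d\psi^{(a)}(x)+\lambda\,\Delta p(c)\,\Delta q(c)$ on real polynomials. For $n\ge1$, $$A_{1}(x;n)=1-\lambda \frac{\Delta Q_{n}^{\lambda }(c)}{\|C_{n-1}^{(a)}\|^{2}}\,\frac{C_{n-1}^{(a)}(c)+(x-c)\Delta C_{n-1}^{(a)}(c)}{(x-c)(x-c-1)},\qquad B_{1}(x;n)=\lambda \frac{\Delta Q_{n}^{\lambda }(c)}{\|C_{n-1}^{(a)}\|^{2}}\,\frac{C_{n}^{(a)}(c)+(x-c)\Delta C_{n}^{(a)}(c)}{(x-c)(x-c-1)}.$$ ${}_rF_s(a_1,\dots,a_r;b_1,\dots,b_s;z)=\sum_{k\ge0}\frac{(a_1)_k\cdots(a_r)_k}{(b_1)_k\cdots(b_s)_k}\frac{z^k}{k!}$ with $(u)_0=1$, $(u)_k=u(u+1)\cdots(u+k-1)$. Here the series terminates because of the parameter $-n$. *)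

theory Defs
  imports "HOL-Probability.Probability"
begin

definition fdiff :: "(real \<Rightarrow> real) \<Rightarrow> real \<Rightarrow> real" where
  "fdiff f x = f (x + 1) - f x"

(* poisson_pmf lives on nat; the embedding real turns the expectation into the integral
   over the nonnegative half-line.  poisson_pmf a is only meaningful for a > 0. *)
definition charlier_ip :: "real \<Rightarrow> real poly \<Rightarrow> real poly \<Rightarrow> real" where
  "charlier_ip a p q =
     measure_pmf.expectation (poisson_pmf a) (\<lambda>k. poly p (real k) * poly q (real k))"

definition sobolev_charlier_ip ::
    "real \<Rightarrow> real \<Rightarrow> real \<Rightarrow> real poly \<Rightarrow> real poly \<Rightarrow> real" where
  "sobolev_charlier_ip a c lam p q =
     charlier_ip a p q + lam * fdiff (poly p) c * fdiff (poly q) c"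

definition monic_OPS :: "(real poly \<Rightarrow> real poly \<Rightarrow> real) \<Rightarrow> (nat \<Rightarrow> real poly) \<Rightarrow> bool" where
  "monic_OPS ip P \<longleftrightarrow>
     (\<forall>n. degree (P n) = n \<and> lead_coeff (P n) = 1) \<and>
     (\<forall>m n. m \<noteq> n \<longrightarrow> ip (P m) (P n) = 0)"

(* The two inner products above are positive definite on real polynomials when a > 0 and
   lam \<ge> 0, so each of these predicates is satisfied by exactly one sequence. *)
definition is_charlier :: "real \<Rightarrow> (nat \<Rightarrow> real poly) \<Rightarrow> bool" where
  "is_charlier a C \<longleftrightarrow> monic_OPS (charlier_ip a) C"

definition is_sobolev_charlier ::
    "real \<Rightarrow> real \<Rightarrow> real \<Rightarrow> (nat \<Rightarrow> real poly) \<Rightarrow> bool" where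
  "is_sobolev_charlier a c lam Q \<longleftrightarrow> monic_OPS (sobolev_charlier_ip a c lam) Q"

(* The connection coefficients A1, B1 are used only for n \<ge> 1, so n - 1 is not truncated.
   They are rational functions of x: at x = c and x = c + 1 the values are artefacts of
   division by zero. *)
definition A1 :: "(nat \<Rightarrow> real poly) \<Rightarrow> (nat \<Rightarrow> real poly) \<Rightarrow> real \<Rightarrow> real \<Rightarrow> real \<Rightarrow> real \<Rightarrow> nat \<Rightarrow> real" where
  "A1 C Q a c lam x n =
     1 - lam * (fdiff (poly (Q n)) c / charlier_ip a (C (n - 1)) (C (n - 1))) *
       ((poly (C (n - 1)) c + (x - c) * fdiff (poly (C (n - 1))) c) / ((x - c) * (x - c - 1)))"

definition B1 :: "(nat \<Rightarrow> real poly) \<Rightarrow> (nat \<Rightarrow> real poly) \<Rightarrow> real \<Rightarrow> real \<Rightarrow> real \<Rightarrow> real \<Rightarrow> nat \<Rightarrow> real" where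
  "B1 C Q a c lam x n =
     lam * (fdiff (poly (Q n)) c / charlier_ip a (C (n - 1)) (C (n - 1))) *
       ((poly (C n) c + (x - c) * fdiff (poly (C n)) c) / ((x - c) * (x - c - 1)))"

definition charlier_phi ::
    "(nat \<Rightarrow> real poly) \<Rightarrow> (nat \<Rightarrow> real poly) \<Rightarrow> real \<Rightarrow> real \<Rightarrow> real \<Rightarrow> real \<Rightarrow> nat \<Rightarrow> real" where
  "charlier_phi C Q a c lam x n =
     real n * (1 - a * (A1 C Q a c lam x n / B1 C Q a c lam x n))"

(* Value at z of the rFs series with upper parameters us and lower parameters bs:
   the k-th coefficient of fps_hypergeo us bs 1 is
   (product of the (u)_k) / ((product of the (b)_k) * k!). *)
definition hypergeo :: "real list \<Rightarrow> real list \<Rightarrow> real \<Rightarrow> real" where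
  "hypergeo us bs z = eval_fps (fps_hypergeo us bs 1) z"

end

theory Submission
  imports Defs
begin

text \<open>
  The identity \<open>E (x p(x)) = a E (p(x + 1))\<close> for the Poisson distribution makes
  \<open>p \<mapsto> x p(x - 1) - a p(x)\<close> the adjoint of \<open>a \<Delta>\<close>. Iterating this operator on the constant
  1 therefore yields the monic Charlier polynomials, together with their norms, the rule
  \<open>\<Delta>C\<^sub>n = n C\<^sub>n\<^sub>-\<^sub>1\<close>, the three-term recurrence and the expansion in Pochhammer symbols.
  Expanding \<open>Q\<^sub>n\<close> in Charlier polynomials gives \<open>C\<^sub>n\<close> minus a multiple of \<open>\<Delta>\<^sub>y K(x, c)\<close>, where \<open>K\<close>
  is the kernel polynomial; by Christoffel--Darboux this is \<open>A\<^sub>1 C\<^sub>n + B\<^sub>1 C\<^sub>n\<^sub>-\<^sub>1\<close>. Finally the two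
  hypergeometric sums merge because \<open>(1 - \<phi>)\<^sub>k / (-\<phi>)\<^sub>k = 1 - k / \<phi>\<close>.
\<close>

section \<open>Expectation of polynomials under the Poisson distribution\<close>

lemma integrable_pmf_nat_iff:
  fixes f :: "nat \<Rightarrow> real"
  shows "integrable (measure_pmf p) f \<longleftrightarrow> summable (\<lambda>k. \<bar>pmf p k * f k\<bar>)"
  by (simp add: measure_pmf_eq_density integrable_real_density integrable_count_space_nat_iff)

lemma expectation_pmf_nat:
  fixes f :: "nat \<Rightarrow> real"
  assumes "integrable (measure_pmf p) f"
  shows "(\<lambda>k. pmf p k * f k) sums measure_pmf.expectation p f"
proof -
  have "integrable (count_space UNIV) (\<lambda>k. pmf p k * f k)"
    using assms by (simp add: measure_pmf_eq_density integrable_real_density)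
  from sums_integral_count_space_nat[OF this] show ?thesis
    by (simp add: measure_pmf_eq_density integral_real_density)
qed

lemma pmf_poisson_Suc:
  assumes "a > 0"
  shows "pmf (poisson_pmf a) (Suc k) * real (Suc k) = a * pmf (poisson_pmf a) k"
  using assms by (simp add: field_simps del: of_nat_Suc)

definition poly_shift :: "real \<Rightarrow> real poly \<Rightarrow> real poly" where
  "poly_shift h p = pcompose p [:h, 1:]"

lemma poly_poly_shift [simp]: "poly (poly_shift h p) x = poly p (x + h)"
  by (simp add: poly_shift_def poly_pcompose add.commute)

lemma degree_poly_shift [simp]: "degree (poly_shift h p) = degree p"
  by (simp add: poly_shift_def degree_pcompose)

lemma lead_coeff_poly_shift [simp]: "coeff (poly_shift h p) (degree p) = lead_coeff p"
  using lead_coeff_comp[of "[:h, 1:]" p] by (simp add: poly_shift_def degree_pcompose)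

text \<open>Removing the constant term leaves \<open>x q(x)\<close>; an index shift turns its series
  into \<open>a\<close> times that of \<open>q(x + 1)\<close>, which has smaller degree unless
  \<open>q = 0\<close>.\<close>

lemma integrable_poisson_poly:
  assumes "a > 0"
  shows "integrable (poisson_pmf a) (\<lambda>k. poly p (real k))"
proof (induction "degree p" arbitrary: p rule: less_induct)
  case less
  obtain b q where p: "p = pCons b q" by (cases p)
  have "summable (\<lambda>k. \<bar>pmf (poisson_pmf a) k * (real k * poly q (real k))\<bar>)"
  proof (cases "q = 0")
    case False
    then have "degree (poly_shift 1 q) < degree p" by (simp add: p)
    then have "summable (\<lambda>k. \<bar>pmf (poisson_pmf a) k * poly q (real k + 1)\<bar>)"
      using less by (fastforce simp: integrable_pmf_nat_iff)
    then have "summable (\<lambda>k. a * \<bar>pmf (poisson_pmf a) k * poly q (real k + 1)\<bar>)"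
      by (rule summable_mult)
    moreover have "\<bar>pmf (poisson_pmf a) (Suc k) * (real (Suc k) * poly q (real (Suc k)))\<bar> =
        a * \<bar>pmf (poisson_pmf a) k * poly q (real k + 1)\<bar>" for k
      using assms
      by (subst mult.assoc[symmetric], subst pmf_poisson_Suc[OF assms]) (simp add: abs_mult add.commute)
    ultimately show ?thesis
      by (subst summable_Suc_iff[symmetric]) simp
  qed simp
  then have "integrable (poisson_pmf a) (\<lambda>k. real k * poly q (real k))"
    by (simp only: integrable_pmf_nat_iff)
  then show ?case by (simp add: p)
qed

definition poisson_poly_exp :: "real \<Rightarrow> real poly \<Rightarrow> real" where
  "poisson_poly_exp a p = measure_pmf.expectation (poisson_pmf a) (\<lambda>k. poly p (real k))"

lemma charlier_ip_eq: "charlier_ip a p q = poisson_poly_exp a (p * q)"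
  by (simp add: charlier_ip_def poisson_poly_exp_def)

lemma poisson_poly_exp_0 [simp]: "poisson_poly_exp a 0 = 0"
  by (simp add: poisson_poly_exp_def)

lemma poisson_poly_exp_1 [simp]: "poisson_poly_exp a 1 = 1"
  by (simp add: poisson_poly_exp_def)

lemma poisson_poly_exp_smult [simp]: "poisson_poly_exp a (smult b p) = b * poisson_poly_exp a p"
  by (simp add: poisson_poly_exp_def)

lemma poly_ext:
  fixes p q :: "real poly"
  assumes "\<And>x. poly p x = poly q x"
  shows "p = q"
  using assms by (simp add: poly_eq_poly_eq_iff[symmetric] fun_eq_iff)

context
  fixes a :: real
  assumes a: "a > 0"
begin

lemma poisson_poly_exp_add: "poisson_poly_exp a (p + q) = poisson_poly_exp a p + poisson_poly_exp a q"
  by (simp add: poisson_poly_exp_def integrable_poisson_poly[OF a])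

lemma poisson_poly_exp_diff: "poisson_poly_exp a (p - q) = poisson_poly_exp a p - poisson_poly_exp a q"
  by (simp add: poisson_poly_exp_def integrable_poisson_poly[OF a])

lemma poisson_poly_exp_sum: "poisson_poly_exp a (\<Sum>i\<in>I. f i) = (\<Sum>i\<in>I. poisson_poly_exp a (f i))"
  by (induction I rule: infinite_finite_induct) (simp_all add: poisson_poly_exp_add)

lemma poisson_poly_exp_shift:
  "poisson_poly_exp a ([:0, 1:] * p) = a * poisson_poly_exp a (poly_shift 1 p)"
proof -
  have "(\<lambda>k. pmf (poisson_pmf a) k * poly (poly_shift 1 p) (real k)) sums
      poisson_poly_exp a (poly_shift 1 p)"
    unfolding poisson_poly_exp_def by (rule expectation_pmf_nat) (rule integrable_poisson_poly[OF a])
  then have "(\<lambda>k. a * (pmf (poisson_pmf a) k * poly (poly_shift 1 p) (real k))) sums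
      (a * poisson_poly_exp a (poly_shift 1 p))"
    by (rule sums_mult)
  also have "(\<lambda>k. a * (pmf (poisson_pmf a) k * poly (poly_shift 1 p) (real k))) =
      (\<lambda>k. pmf (poisson_pmf a) (Suc k) * poly ([:0, 1:] * p) (real (Suc k)))"
  proof
    fix k
    have "pmf (poisson_pmf a) (Suc k) * poly ([:0, 1:] * p) (real (Suc k)) =
        (pmf (poisson_pmf a) (Suc k) * real (Suc k)) * poly p (real k + 1)"
      by (simp add: add.commute del: pmf_poisson)
    then show "a * (pmf (poisson_pmf a) k * poly (poly_shift 1 p) (real k)) =
        pmf (poisson_pmf a) (Suc k) * poly ([:0, 1:] * p) (real (Suc k))"
      by (simp only: pmf_poisson_Suc[OF a]) simp
  qed
  \<comment> \<open>The term at index 0, missing from the shifted series, is zero because of the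
    factor \<open>x\<close>.\<close>
  finally have "(\<lambda>k. pmf (poisson_pmf a) k * poly ([:0, 1:] * p) (real k)) sums
      (a * poisson_poly_exp a (poly_shift 1 p))"
    by (subst (asm) sums_Suc_iff) simp
  moreover have "(\<lambda>k. pmf (poisson_pmf a) k * poly ([:0, 1:] * p) (real k)) sums
      poisson_poly_exp a ([:0, 1:] * p)"
    unfolding poisson_poly_exp_def by (rule expectation_pmf_nat) (rule integrable_poisson_poly[OF a])
  ultimately show ?thesis by (rule sums_unique2[symmetric])
qed

text \<open>Every natural number carries positive mass, so \<open>p\<close> has infinitely many
  zeros.\<close>

lemma poisson_poly_exp_square_eq_0:
  assumes "poisson_poly_exp a (p * p) = 0"
  shows "p = 0"
proof -
  have "AE k in poisson_pmf a. poly (p * p) (real k) = 0"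
    using assms integral_nonneg_eq_0_iff_AE[OF integrable_poisson_poly[OF a, of "p * p"]]
    by (simp add: poisson_poly_exp_def)
  then have "\<forall>k. poly p (real k) = 0"
    using a by (simp add: AE_measure_pmf_iff)
  then have "range real \<subseteq> {x. poly p x = 0}" by auto
  moreover have "infinite (range real)"
    by (simp add: finite_image_iff inj_on_def)
  ultimately show ?thesis
    using poly_roots_finite finite_subset by blast
qed

section \<open>Charlier polynomials\<close>

text \<open>Built with the raising operator rather than the three-term recurrence, so that the
  adjoint relation follows from one unfolding.\<close>

primrec charlier_poly :: "nat \<Rightarrow> real poly" where
  "charlier_poly 0 = 1"
| "charlier_poly (Suc n) =
     [:0, 1:] * poly_shift (-1) (charlier_poly n) - smult a (charlier_poly n)"

lemma charlier_poly_monic: "degree (charlier_poly n) = n \<and> coeff (charlier_poly n) n = 1"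
proof (induction n)
  case (Suc n)
  let ?s = "[:0, 1:] * poly_shift (-1) (charlier_poly n)"
  have nz: "poly_shift (-1) (charlier_poly n) \<noteq> 0"
    using Suc by (metis coeff_0 lead_coeff_poly_shift zero_neq_one)
  have d: "degree ?s = Suc n"
    using nz Suc by (subst degree_mult_eq) auto
  have l: "coeff ?s (Suc n) = 1"
    using Suc lead_coeff_poly_shift[of "-1" "charlier_poly n"] by simp
  have "degree (smult a (charlier_poly n)) < degree ?s"
    using d Suc a by simp
  then have "degree (charlier_poly (Suc n)) = degree ?s"
    by (simp add: degree_add_eq_left[of "- smult a (charlier_poly n)" ?s, simplified])
  moreover have "coeff (charlier_poly n) (Suc n) = 0"
    using Suc by (simp add: coeff_eq_0)
  ultimately show ?case
    using d l by simp
qed simp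

text \<open>The shift identity, applied to \<open>x C(x - 1) q(x)\<close>, restores
  \<open>C(x)\<close> and moves the shift onto \<open>q\<close>.\<close>

lemma charlier_adjoint:
  "poisson_poly_exp a (charlier_poly (Suc n) * q) =
     a * poisson_poly_exp a (charlier_poly n * (poly_shift 1 q - q))"
proof -
  have "charlier_poly (Suc n) * q =
      [:0, 1:] * (poly_shift (-1) (charlier_poly n) * q) - smult a (charlier_poly n * q)"
    by (simp add: algebra_simps)
  moreover have "poly_shift 1 (poly_shift (-1) (charlier_poly n) * q) =
      charlier_poly n * poly_shift 1 q"
    by (rule poly_ext) simp
  ultimately show ?thesis
    by (simp only: poisson_poly_exp_diff poisson_poly_exp_shift poisson_poly_exp_smult
        right_diff_distrib)
qed

text \<open>Each adjoint step lowers the index and the degree bound on \<open>q\<close> by one. The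
  bound is put on coefficients so that \<open>n = 0\<close> forces \<open>q = 0\<close>.\<close>

lemma charlier_orthogonal_lower:
  assumes "\<forall>i\<ge>n. coeff q i = 0"
  shows "poisson_poly_exp a (charlier_poly n * q) = 0"
  using assms
proof (induction n arbitrary: q)
  case 0
  then have "q = 0" by (simp add: poly_eq_iff)
  then show ?case by simp
next
  case (Suc n)
  have "coeff (poly_shift 1 q - q) i = 0" if "i \<ge> n" for i
  proof (cases "i = degree q")
    case True
    \<comment> \<open>A shift keeps the leading coefficient, so it cancels in the
      difference.\<close>
    then show ?thesis by simp
  next
    case False
    moreover have "degree q \<le> n"
      using Suc.prems by (intro degree_le) auto
    ultimately show ?thesis using that by (simp add: coeff_eq_0)
  qed
  then have "poisson_poly_exp a (charlier_poly n * (poly_shift 1 q - q)) = 0"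
    by (intro Suc.IH) auto
  then show ?case
    by (simp only: charlier_adjoint mult_zero_right)
qed

text \<open>For the raising operator R, \<open>\<Delta> R = R \<Delta> + 1\<close>; hence
  differencing the n-th iterate yields n times the previous one.\<close>

lemma charlier_poly_delta:
  "poly (charlier_poly n) (x + 1) - poly (charlier_poly n) x = real n * poly (charlier_poly (n - 1)) x"
proof (induction n arbitrary: x)
  case (Suc n)
  have "poly (charlier_poly (Suc n)) (x + 1) - poly (charlier_poly (Suc n)) x =
      poly (charlier_poly n) x + x * (poly (charlier_poly n) ((x - 1) + 1) - poly (charlier_poly n) (x - 1))
      - a * (poly (charlier_poly n) (x + 1) - poly (charlier_poly n) x)"
    by (simp add: algebra_simps)
  also have "\<dots> = poly (charlier_poly n) x +
      real n * (x * poly (charlier_poly (n - 1)) (x - 1) - a * poly (charlier_poly (n - 1)) x)"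
    unfolding Suc.IH by (simp add: algebra_simps)
  \<comment> \<open>For \<open>n = 0\<close> the factor \<open>real n\<close> removes the truncated
    index; otherwise the bracket is the defining equation of \<open>charlier_poly n\<close>.\<close>
  also have "\<dots> = real (Suc n) * poly (charlier_poly n) x"
    by (cases n) (simp_all add: algebra_simps)
  finally show ?case by simp
qed simp

text \<open>The difference rule at \<open>x - 1\<close> eliminates the shifted value in the
  definition; the remaining shifted value of index \<open>n - 1\<close> is read off from the
  definition of index \<open>n\<close>.\<close>

lemma charlier_poly_rec:
  "poly (charlier_poly (Suc n)) x =
     (x - real n - a) * poly (charlier_poly n) x - real n * a * poly (charlier_poly (n - 1)) x"
proof -
  have "x * poly (charlier_poly n) (x - 1) =
      x * (poly (charlier_poly n) x - real n * poly (charlier_poly (n - 1)) (x - 1))"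
    using charlier_poly_delta[of n "x - 1"] by simp
  also have "\<dots> = x * poly (charlier_poly n) x -
      real n * (poly (charlier_poly n) x + a * poly (charlier_poly (n - 1)) x)"
    by (cases n) (simp_all add: algebra_simps)
  finally show ?thesis by (simp add: algebra_simps)
qed

lemma charlier_poly_norm:
  "poisson_poly_exp a (charlier_poly n * charlier_poly n) = fact n * a ^ n"
proof (induction n)
  case (Suc n)
  have "poly_shift 1 (charlier_poly (Suc n)) - charlier_poly (Suc n) = smult (real (Suc n)) (charlier_poly n)"
    using charlier_poly_delta[of "Suc n"] by (intro poly_ext) (simp del: charlier_poly.simps of_nat_Suc)
  then show ?case
    by (subst charlier_adjoint) (simp add: Suc del: of_nat_Suc charlier_poly.simps)
qed simp

text \<open>This is the classical 2F0 form with \<open>(-n)_k / k!\<close> written as a signed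
  binomial coefficient. Since \<open>x (1 - x)_k = -(-x)_(k+1)\<close>, the raising operator acts on
  the coefficients as Pascal's rule.\<close>

lemma charlier_poly_pochhammer:
  "poly (charlier_poly n) x = (- a) ^ n * (\<Sum>k\<le>n. real (n choose k) * pochhammer (- x) k / a ^ k)"
proof (induction n arbitrary: x)
  case (Suc n)
  define g where "g k = pochhammer (- x) k / a ^ k" for k
  have "x * (real (n choose k) * pochhammer (1 - x) k / a ^ k) = - a * (real (n choose k) * g (Suc k))" for k
    using a by (simp add: g_def pochhammer_rec field_simps)
  then have shift: "x * (\<Sum>k\<le>n. real (n choose k) * pochhammer (1 - x) k / a ^ k) =
      - a * (\<Sum>k\<le>n. real (n choose k) * g (Suc k))"
    by (simp only: sum_distrib_left)
  have "(\<Sum>k\<le>Suc n. real (Suc n choose k) * g k) =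
      g 0 + (\<Sum>k\<le>n. real (n choose Suc k) * g (Suc k)) + (\<Sum>k\<le>n. real (n choose k) * g (Suc k))"
    by (subst sum.atMost_Suc_shift) (simp add: sum.distrib algebra_simps)
  also have "g 0 + (\<Sum>k\<le>n. real (n choose Suc k) * g (Suc k)) = (\<Sum>k\<le>Suc n. real (n choose k) * g k)"
    by (subst sum.atMost_Suc_shift) simp
  also have "\<dots> = (\<Sum>k\<le>n. real (n choose k) * g k)"
    by simp
  finally have pascal: "(\<Sum>k\<le>Suc n. real (Suc n choose k) * g k) =
      (\<Sum>k\<le>n. real (n choose k) * g k) + (\<Sum>k\<le>n. real (n choose k) * g (Suc k))" .
  have "poly (charlier_poly (Suc n)) x =
      (- a) ^ n * (x * (\<Sum>k\<le>n. real (n choose k) * pochhammer (1 - x) k / a ^ k))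
      - a * ((- a) ^ n * (\<Sum>k\<le>n. real (n choose k) * g k))"
    by (simp add: Suc g_def)
  also have "\<dots> = (- a) ^ Suc n * (\<Sum>k\<le>Suc n. real (Suc n choose k) * g k)"
    unfolding shift pascal by (simp add: algebra_simps)
  finally show ?case by (simp only: g_def times_divide_eq_right)
qed simp

text \<open>In the recurrence the coefficients at \<open>x\<close> and \<open>y\<close> differ by
  \<open>x - y\<close> only; dividing by the norm absorbs the factor
  \<open>(n + 1) a\<close>.\<close>

lemma charlier_christoffel_darboux:
  "(x - y) * (\<Sum>k<Suc n. poly (charlier_poly k) x * poly (charlier_poly k) y / (fact k * a ^ k)) =
     (poly (charlier_poly (Suc n)) x * poly (charlier_poly n) y -
      poly (charlier_poly n) x * poly (charlier_poly (Suc n)) y) / (fact n * a ^ n)"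
proof (induction n)
  case (Suc n)
  let ?C = "\<lambda>k. poly (charlier_poly k)"
  have "(?C (Suc (Suc n)) x * ?C (Suc n) y - ?C (Suc n) x * ?C (Suc (Suc n)) y) =
      (x - y) * (?C (Suc n) x * ?C (Suc n) y)
      + (real (Suc n) * a) * (?C (Suc n) x * ?C n y - ?C n x * ?C (Suc n) y)"
    unfolding charlier_poly_rec[of "Suc n"] by (simp add: algebra_simps del: charlier_poly.simps)
  then have "(?C (Suc (Suc n)) x * ?C (Suc n) y - ?C (Suc n) x * ?C (Suc (Suc n)) y) / (fact (Suc n) * a ^ Suc n) =
      (x - y) * (?C (Suc n) x * ?C (Suc n) y / (fact (Suc n) * a ^ Suc n))
      + (?C (Suc n) x * ?C n y - ?C n x * ?C (Suc n) y) / (fact n * a ^ n)"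
    using a by (simp add: add_divide_distrib del: charlier_poly.simps of_nat_Suc)
  then show ?case
    by (subst sum.lessThan_Suc) (simp only: distrib_left Suc.IH add.commute)
qed (simp add: algebra_simps)

section \<open>Uniqueness and the connection formula\<close>

text \<open>Triangular elimination: cancelling the coefficient at \<open>n\<close> with
  \<open>P n\<close> lowers the bound. It transfers orthogonality from one monic family to any
  polynomial of lower degree.\<close>

lemma linear_functional_vanishes:
  fixes L :: "real poly \<Rightarrow> real" and P :: "nat \<Rightarrow> real poly"
  assumes "L 0 = 0" and lin: "\<And>b p q. L (p + smult b q) = L p + b * L q"
    and monic: "\<And>k. degree (P k) = k \<and> coeff (P k) k = 1"
    and "\<forall>k<n. L (P k) = 0" and "\<forall>i\<ge>n. coeff q i = 0"
  shows "L q = 0"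
  using assms(4,5)
proof (induction n arbitrary: q)
  case 0
  then have "q = 0" by (simp add: poly_eq_iff)
  then show ?case using \<open>L 0 = 0\<close> by simp
next
  case (Suc n)
  let ?r = "q + smult (- coeff q n) (P n)"
  have "\<forall>i\<ge>n. coeff ?r i = 0"
  proof (intro allI impI)
    fix i assume "i \<ge> n"
    then show "coeff ?r i = 0"
      using monic[of n] Suc.prems(2) by (cases "i = n") (simp_all add: coeff_eq_0)
  qed
  moreover have "\<forall>k<n. L (P k) = 0" using Suc.prems(1) less_SucI by blast
  ultimately have "L ?r = 0" by (intro Suc.IH)
  then show ?case using Suc.prems(1) lin[of q "- coeff q n" "P n"] by simp
qed

text \<open>Such an \<open>r\<close> lies in the span of the polynomials it is orthogonal to, hence
  is orthogonal to itself.\<close>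

lemma eq_0_if_charlier_orthogonal:
  assumes "\<forall>k<n. poisson_poly_exp a (charlier_poly k * r) = 0" and "\<forall>i\<ge>n. coeff r i = 0"
  shows "r = 0"
proof (rule poisson_poly_exp_square_eq_0)
  show "poisson_poly_exp a (r * r) = 0"
    by (rule linear_functional_vanishes[where L = "\<lambda>q. poisson_poly_exp a (q * r)" and P = charlier_poly])
      (use assms charlier_poly_monic in \<open>auto simp: distrib_right poisson_poly_exp_add\<close>)
qed

lemma monic_diff_coeff:
  fixes p q :: "'a::comm_ring_1 poly"
  assumes "degree p = n \<and> coeff p n = 1" and "degree q = n \<and> coeff q n = 1" and "i \<ge> n"
  shows "coeff (p - q) i = 0"
  using assms by (cases "i = n") (auto simp: coeff_eq_0)

lemma is_charlier_unique:
  assumes "is_charlier a C"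
  shows "C = charlier_poly"
proof
  fix n
  have C: "\<And>k. degree (C k) = k \<and> coeff (C k) k = 1"
    using assms unfolding is_charlier_def monic_OPS_def by metis
  have orth: "\<And>m k. m \<noteq> k \<Longrightarrow> poisson_poly_exp a (C m * C k) = 0"
    using assms by (auto simp: is_charlier_def monic_OPS_def charlier_ip_eq)
  \<comment> \<open>\<open>C n\<close> is known to be orthogonal only to the other
    \<open>C k\<close>; elimination along \<open>C\<close> extends this to
    \<open>charlier_poly k\<close>.\<close>
  have "poisson_poly_exp a (charlier_poly k * C n) = 0" if "k < n" for k
    by (rule linear_functional_vanishes[where L = "\<lambda>q. poisson_poly_exp a (q * C n)" and P = C and n = n])
      (use that C orth charlier_poly_monic[of k] in
        \<open>auto simp: distrib_right poisson_poly_exp_add coeff_eq_0\<close>)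
  moreover have "poisson_poly_exp a (charlier_poly k * charlier_poly n) = 0" if "k < n" for k
    using charlier_orthogonal_lower[of n "charlier_poly k"] that charlier_poly_monic[of k]
    by (simp add: mult.commute coeff_eq_0)
  moreover have "coeff (C n - charlier_poly n) i = 0" if "i \<ge> n" for i
    using C charlier_poly_monic that by (rule monic_diff_coeff)
  ultimately have "C n - charlier_poly n = 0"
    by (intro eq_0_if_charlier_orthogonal[of n])
      (simp_all add: right_diff_distrib poisson_poly_exp_diff)
  then show "C n = charlier_poly n" by simp
qed

section \<open>Expansion of the Sobolev-type polynomials in the Charlier basis\<close>

lemma charlier_orthogonal:
  "poisson_poly_exp a (charlier_poly j * charlier_poly k) = (if j = k then fact k * a ^ k else 0)"
proof (cases j k rule: linorder_cases)
  case less
  then show ?thesis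
    using charlier_orthogonal_lower[of k "charlier_poly j"] charlier_poly_monic[of j]
    by (simp add: mult.commute coeff_eq_0)
next
  case greater
  then show ?thesis
    using charlier_orthogonal_lower[of j "charlier_poly k"] charlier_poly_monic[of k]
    by (simp add: coeff_eq_0)
qed (simp add: charlier_poly_norm)

text \<open>Sobolev orthogonality fixes the Poisson pairing of \<open>Q n\<close> with each lower
  Charlier polynomial. The formula is implicit, \<open>fdiff (poly (Q n)) c\<close> staying on the
  right as it does in \<open>A1\<close> and \<open>B1\<close>.\<close>

lemma sobolev_charlier_expansion:
  assumes "is_sobolev_charlier a c lam Q"
  shows "Q n = charlier_poly n - smult (lam * fdiff (poly (Q n)) c)
    (\<Sum>k<n. smult (fdiff (poly (charlier_poly k)) c / (fact k * a ^ k)) (charlier_poly k))"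
    (is "_ = ?R")
proof -
  let ?d = "\<lambda>p. fdiff (poly p) c"
  let ?K = "\<Sum>k<n. smult (?d (charlier_poly k) / (fact k * a ^ k)) (charlier_poly k)"
  have Q: "\<And>k. degree (Q k) = k \<and> coeff (Q k) k = 1"
    using assms unfolding is_sobolev_charlier_def monic_OPS_def by metis
  have orth: "\<And>m k. m \<noteq> k \<Longrightarrow> poisson_poly_exp a (Q m * Q k) + lam * ?d (Q m) * ?d (Q k) = 0"
    using assms by (auto simp: is_sobolev_charlier_def monic_OPS_def sobolev_charlier_ip_def charlier_ip_eq)
  \<comment> \<open>\<open>?K\<close> is the differenced reproducing kernel: pairing with it
    evaluates the difference at \<open>c\<close>.\<close>
  have K: "poisson_poly_exp a (charlier_poly k * ?K) = ?d (charlier_poly k)" if "k < n" for k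
    using that a
    by (simp add: sum_distrib_left poisson_poly_exp_sum charlier_orthogonal if_distrib cong: if_cong)
  have "poisson_poly_exp a (charlier_poly k * Q n) + lam * ?d (charlier_poly k) * ?d (Q n) = 0" if "k < n" for k
    by (rule linear_functional_vanishes[where
          L = "\<lambda>q. poisson_poly_exp a (q * Q n) + lam * ?d q * ?d (Q n)" and P = Q and n = n])
      (use that Q orth charlier_poly_monic[of k] in
        \<open>auto simp: distrib_right poisson_poly_exp_add coeff_eq_0 fdiff_def algebra_simps\<close>)
  note Qk = this
  have "poisson_poly_exp a (charlier_poly k * (Q n - ?R)) = 0" if "k < n" for k
  proof -
    have "charlier_poly k * (Q n - ?R) = charlier_poly k * Q n - charlier_poly k * charlier_poly n
        + smult (lam * ?d (Q n)) (charlier_poly k * ?K)"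
      by (simp add: right_diff_distrib)
    then show ?thesis
      using that Qk[OF that]
      by (simp only: poisson_poly_exp_add poisson_poly_exp_diff poisson_poly_exp_smult K
          charlier_orthogonal) (simp add: mult.commute mult.left_commute)
  qed
  moreover have "coeff (Q n - ?R) i = 0" if "i \<ge> n" for i
  proof -
    have "coeff (charlier_poly k) i = 0" if "k < n" for k
      using that \<open>i \<ge> n\<close> charlier_poly_monic[of k] by (simp add: coeff_eq_0)
    then have "coeff ?K i = 0" by (simp add: coeff_sum)
    then show ?thesis
      using monic_diff_coeff[OF Q charlier_poly_monic that] by simp
  qed
  ultimately have "Q n - ?R = 0"
    by (intro eq_0_if_charlier_orthogonal[of n]) auto
  then show ?thesis by simp
qed

lemma sobolev_charlier_connection:
  assumes "is_sobolev_charlier a c lam Q" and "n \<ge> 1" and "x \<noteq> c" and "x \<noteq> c + 1"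
  shows "poly (Q n) x = A1 charlier_poly Q a c lam x n * poly (charlier_poly n) x
    + B1 charlier_poly Q a c lam x n * poly (charlier_poly (n - 1)) x"
proof -
  obtain m where n: "n = Suc m" using assms(2) by (cases n) auto
  let ?C = "\<lambda>k. poly (charlier_poly k)"
  define S where "S y = (\<Sum>k<n. ?C k x * ?C k y / (fact k * a ^ k))" for y
  define h where "h = fact m * a ^ m"
  define u where "u k = (?C k c + (x - c) * fdiff (?C k) c) / ((x - c) * (x - c - 1))" for k
  have h: "h \<noteq> 0" using a by (simp add: h_def)
  have xc: "x - c \<noteq> 0" "x - c - 1 \<noteq> 0" using assms by auto
  have "(x - y) * S y = (?C n x * ?C m y - ?C m x * ?C n y) / h" for y
    unfolding S_def h_def n by (rule charlier_christoffel_darboux)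
  \<comment> \<open>The difference at \<open>c\<close> needs the kernel only at \<open>c\<close> and
    \<open>c + 1\<close>, which produces the two denominators.\<close>
  note cd = this[of c] this[of "c + 1"]
  have S: "S c = (?C n x * ?C m c - ?C m x * ?C n c) / (h * (x - c))"
    "S (c + 1) = (?C n x * ?C m (c + 1) - ?C m x * ?C n (c + 1)) / (h * (x - c - 1))"
    using cd xc h by (simp_all add: eq_divide_eq mult.assoc[symmetric] diff_diff_eq)
      (simp_all add: algebra_simps)
  have "poly (Q n) x = ?C n x - lam * fdiff (poly (Q n)) c * (S (c + 1) - S c)"
    by (subst sobolev_charlier_expansion[OF assms(1)])
      (simp add: poly_sum S_def fdiff_def sum_subtractf[symmetric] diff_divide_distrib algebra_simps)
  \<comment> \<open>Over the common denominator, \<open>(x - c) p(c + 1) - (x - c - 1) p(c)\<close>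
    is \<open>p(c) + (x - c) \<Delta>p(c)\<close>.\<close>
  also have "\<dots> = ?C n x - lam * fdiff (poly (Q n)) c * (?C n x * u m / h - ?C m x * u n / h)"
    unfolding S u_def fdiff_def using xc h by (simp add: divide_simps) (simp add: algebra_simps)
  also have "\<dots> = (1 - lam * (fdiff (poly (Q n)) c / h) * u m) * ?C n x
      + lam * (fdiff (poly (Q n)) c / h) * u n * ?C m x"
    by (simp add: algebra_simps)
  finally show ?thesis
    unfolding A1_def B1_def charlier_ip_eq n diff_Suc_1 charlier_poly_norm h_def u_def .
qed

end

section \<open>The hypergeometric representation\<close>

lemma hypergeo_terminating:
  "hypergeo (- real n # us) bs z =
     (\<Sum>k\<le>n. fps_nth (fps_hypergeo (- real n # us) bs 1) k * z ^ k)"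
proof -
  \<comment> \<open>Once \<open>(-n)_k\<close> is zero, the product over the remaining upper
    parameters stays zero, and so does its quotient, whatever \<open>bs\<close> is.\<close>
  have foldl0: "foldl (\<lambda>r u. r * f u) 0 us = (0::real)" for f :: "real \<Rightarrow> real"
    by (induction us) auto
  have "pochhammer (- real n) k = 0" if "k > n" for k
    using that by (rule pochhammer_of_nat_eq_0_lemma)
  then have "fps_nth (fps_hypergeo (- real n # us) bs 1) k = 0" if "k > n" for k
    using that by (simp add: foldl0)
  then show ?thesis
    unfolding hypergeo_def eval_fps_def by (intro suminf_finite) (simp_all add: not_le del: fps_hypergeo_nth)
qed

lemma pochhammer_minus_binomial:
  "pochhammer (- real n) k / fact k = (-1) ^ k * real (n choose k)"
  by (simp add: binomial_gbinomial gbinomial_pochhammer flip: power_mult_distrib mult.assoc)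

text \<open>Both \<open>-f (1 - f)_k\<close> and \<open>(-f)_k (k - f)\<close> equal
  \<open>(-f)_(k+1)\<close>.\<close>

lemma pochhammer_ratio:
  fixes f :: real
  assumes "f \<noteq> 0" and "pochhammer (- f) k \<noteq> 0"
  shows "pochhammer (1 - f) k / pochhammer (- f) k = 1 - real k / f"
proof -
  have "- f * pochhammer (1 - f) k = pochhammer (- f) k * (real k - f)"
    using pochhammer_rec[of "- f" k] pochhammer_Suc[of "- f" k] by simp
  then show ?thesis using assms by (simp add: field_simps)
qed

text \<open>Lets the expansions of indices \<open>n\<close> and \<open>n - 1\<close> share their
  terms, up to a factor affine in \<open>k\<close>.\<close>

lemma binomial_pred_left:
  assumes "n \<ge> 1"
  shows "real (n - 1 choose k) = real (n choose k) * (1 - real k / real n)"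
proof (cases "k \<le> n")
  case True
  have "n * (n - 1 choose k) = (n - k) * (n choose k)"
    using assms binomial_absorb_comp[of n k] by simp
  then have "real n * real (n - 1 choose k) = (real n - real k) * real (n choose k)"
    using True by (metis of_nat_diff of_nat_mult)
  then show ?thesis using assms by (simp add: field_simps)
qed (use assms in \<open>simp add: binomial_eq_0\<close>)

theorem proposition4:
  fixes a c lam x :: real and n :: nat and C Q :: "nat \<Rightarrow> real poly"
  assumes "a > 0"
    and "lam \<ge> 0"
    and "{c<..<c + 1} \<inter> \<nat> = {}"
    and "n \<ge> 1"
    and "is_charlier a C"
    and "is_sobolev_charlier a c lam Q"
    \<comment> \<open>the next four conditions say that the right-hand side is defined at x:
        no denominator of A1, B1, phi, or of the terms 0..n of the 3F1 vanishes\<close>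
    and "x \<noteq> c"
    and "x \<noteq> c + 1"
    and "B1 C Q a c lam x n \<noteq> 0"
    and "\<forall>k\<le>n. pochhammer (- charlier_phi C Q a c lam x n) k \<noteq> 0"
  shows "poly (Q n) x =
           (- a) ^ (n - 1) * (B1 C Q a c lam x n - a * A1 C Q a c lam x n) *
           hypergeo [- real n, - x, 1 - charlier_phi C Q a c lam x n]
                    [- charlier_phi C Q a c lam x n] (- 1 / a)"
proof -
  have C: "C = charlier_poly a" using assms by (intro is_charlier_unique)
  define A where "A = A1 C Q a c lam x n"
  define B where "B = B1 C Q a c lam x n"
  define f where "f = charlier_phi C Q a c lam x n"
  have B: "B \<noteq> 0" and poch: "\<forall>k\<le>n. pochhammer (- f) k \<noteq> 0"
    using assms by (simp_all add: B_def f_def)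
  \<comment> \<open>\<open>(-f)_1 = -f\<close>, and \<open>n \<ge> 1\<close> puts the index 1 in
    range.\<close>
  have f: "f \<noteq> 0" using poch[rule_format, of 1] assms(4) by simp
  have phi: "B * f = real n * (B - a * A)"
    using B unfolding f_def charlier_phi_def A_def[symmetric] B_def[symmetric] by (simp add: field_simps)
  let ?t = "\<lambda>k. real (n choose k) * pochhammer (- x) k / a ^ k"
  define X where "X = (\<Sum>k\<le>n. ?t k)"
  define Y where "Y = (\<Sum>k\<le>n. ?t k * (1 - real k / real n))"
  \<comment> \<open>Both sides are affine in \<open>k\<close> with the same constant term;
    \<open>phi\<close> says exactly that the slopes agree.\<close>
  have coeff: "B * (1 - real k / real n) - a * A = (B - a * A) * (1 - real k / f)" for k
  proof -
    have "(B - a * A) / f = B / real n"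
      using phi f assms(4) by (simp add: field_simps)
    moreover have "(B - a * A) * (1 - real k / f) = (B - a * A) - real k * ((B - a * A) / f)"
      by (simp add: right_diff_distrib left_diff_distrib diff_divide_distrib mult.commute)
    ultimately show ?thesis by (simp add: right_diff_distrib)
  qed
  \<comment> \<open>The sign of \<open>(-n)_k\<close> cancels that of the argument
    \<open>-1/a\<close>.\<close>
  have sign: "(- 1) ^ k * (- 1 / a) ^ k = 1 / a ^ k" for k
    by (subst power_mult_distrib[symmetric]) (simp add: power_one_over)
  have "hypergeo [- real n, - x, 1 - f] [- f] (- 1 / a) = (\<Sum>k\<le>n. ?t k * (1 - real k / f))"
    unfolding hypergeo_terminating
  proof (rule sum.cong)
    fix k assume "k \<in> {..n}"
    then have "pochhammer (1 - f) k / pochhammer (- f) k = 1 - real k / f"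
      using f poch by (intro pochhammer_ratio) auto
    moreover have "fps_nth (fps_hypergeo [- real n, - x, 1 - f] [- f] 1) k * (- 1 / a) ^ k =
        (pochhammer (- real n) k / fact k) * pochhammer (- x) k
        * (pochhammer (1 - f) k / pochhammer (- f) k) * (- 1 / a) ^ k"
      by simp
    ultimately have "fps_nth (fps_hypergeo [- real n, - x, 1 - f] [- f] 1) k * (- 1 / a) ^ k =
        real (n choose k) * pochhammer (- x) k * (1 - real k / f) * ((- 1) ^ k * (- 1 / a) ^ k)"
      unfolding pochhammer_minus_binomial by (simp only: mult_ac)
    then show "fps_nth (fps_hypergeo [- real n, - x, 1 - f] [- f] 1) k * (- 1 / a) ^ k =
        ?t k * (1 - real k / f)"
      unfolding sign by simp
  qed simp
  then have rhs: "(B - a * A) * hypergeo [- real n, - x, 1 - f] [- f] (- 1 / a) =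
      (\<Sum>k\<le>n. ?t k * (B * (1 - real k / real n) - a * A))"
    by (simp add: coeff sum_distrib_left mult.left_commute)
  \<comment> \<open>The sum is extended to \<open>k = n\<close>, where \<open>n - 1 choose k\<close>
    is zero, to match the range for index \<open>n\<close>.\<close>
  have "poly (charlier_poly a (n - 1)) x =
      (- a) ^ (n - 1) * (\<Sum>k\<le>n. real (n - 1 choose k) * pochhammer (- x) k / a ^ k)"
    unfolding charlier_poly_pochhammer[OF assms(1)]
    by (intro arg_cong2[where f = "(*)"] sum.mono_neutral_left) (use assms(4) in auto)
  also have "(\<Sum>k\<le>n. real (n - 1 choose k) * pochhammer (- x) k / a ^ k) = Y"
    unfolding Y_def binomial_pred_left[OF assms(4)] by (simp add: mult_ac)
  finally have pred: "poly (charlier_poly a (n - 1)) x = (- a) ^ (n - 1) * Y" .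
  \<comment> \<open>The spare factor \<open>- a\<close> is what turns \<open>A\<close> into
    \<open>- a * A\<close>.\<close>
  have "(- a) ^ n = (- a) ^ (n - 1) * (- a)"
    using assms(4) by (cases n) simp_all
  then have same: "poly (charlier_poly a n) x = (- a) ^ (n - 1) * (- a) * X"
    unfolding charlier_poly_pochhammer[OF assms(1), of n x] X_def by simp
  have ring: "B * (u * v) - a * A * u = u * (B * v - a * A)" for u v
    by algebra
  have "poly (Q n) x = A * poly (charlier_poly a n) x + B * poly (charlier_poly a (n - 1)) x"
    unfolding A_def B_def C by (rule sobolev_charlier_connection) (fact assms)+
  also have "\<dots> = (- a) ^ (n - 1) * (B * Y - a * A * X)"
    unfolding pred same by (simp add: algebra_simps)
  also have "B * Y - a * A * X = (\<Sum>k\<le>n. ?t k * (B * (1 - real k / real n) - a * A))"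
    unfolding X_def Y_def sum_distrib_left sum_subtractf[symmetric]
    by (intro sum.cong refl ring)
  finally show ?thesis
    unfolding rhs[symmetric] unfolding A_def B_def f_def by (simp only: mult.assoc)
qed

end
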